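(* Let $T$ be a tree on $n\ge 2$ vertices. Then $\gamma_{MR}(T)\le 2n-3\beta_0(T)$, where $\beta_0(T)$ is the independence number of $T$ (the maximum cardinality of an independent set of vertices).
   Context: All graphs are finite and simple. For a vertex $v$ of $G=(V,E)$, $N[v]=\{v\}\cup\{u: uv\in E\}$ is the closed neighborhood, and for $f:V\to\mathbb{R}$ and $S\subseteq V$, $f(S)=\sum_{x\in S}f(x)$. A majority Roman dominating function (MRDF) on $G$ is a function $f:V\to\{-1,1,2\}$ such that (i) $f(N[v])\ge 1$ for at least half of the vertices $v\in V$, and (ii) every vertex $u$ with $f(u)=-1$ is adjacent to at least one vertex $w$ with $f(w)=2$. The weight of $f$ is $f(V)$, and the majority Roman domination number $\gamma_{MR}(G)$ is the minimum weight of an MRDF on $G$. *)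

theory Defs
  imports "Graph_Theory.Graph_Theory"
begin

(* Finite simple graphs are symmetric digraphs without loops and parallel arcs, locale graph.
   The library constants forest and tree are not used: in a symmetric digraph every edge u-v
   gives the directed 2-cycle u, v, u, so there only edgeless graphs are forests.
   A cycle of the undirected graph is a cycle of the digraph with at least three arcs. *)
definition undirected_tree :: "('a, 'b) pre_digraph \<Rightarrow> bool" where
  "undirected_tree G \<longleftrightarrow> graph G \<and> Digraph_Component.connected G \<and>
     \<not> (\<exists>p. pre_digraph.cycle G p \<and> 3 \<le> length p)"

definition closed_nbhd :: "('a, 'b) pre_digraph \<Rightarrow> 'a \<Rightarrow> 'a set" where
  "closed_nbhd G v = insert v {u. u \<rightarrow>\<^bsub>G\<^esub> v}"

definition MRDF :: "('a, 'b) pre_digraph \<Rightarrow> ('a \<Rightarrow> int) \<Rightarrow> bool" where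
  "MRDF G f \<longleftrightarrow>
     (\<forall>v\<in>verts G. f v \<in> {-1, 1, 2}) \<and>
     card (verts G) \<le> 2 * card {v \<in> verts G. sum f (closed_nbhd G v) \<ge> 1} \<and>
     (\<forall>u\<in>verts G. f u = -1 \<longrightarrow> (\<exists>w\<in>verts G. u \<rightarrow>\<^bsub>G\<^esub> w \<and> f w = 2))"

definition majority_roman_domination_number :: "('a, 'b) pre_digraph \<Rightarrow> int" where
  "majority_roman_domination_number G = Min {sum f (verts G) | f. MRDF G f}"

definition independent_vertices :: "('a, 'b) pre_digraph \<Rightarrow> 'a set \<Rightarrow> bool" where
  "independent_vertices G S \<longleftrightarrow> S \<subseteq> verts G \<and> (\<forall>u\<in>S. \<forall>v\<in>S. \<not> u \<rightarrow>\<^bsub>G\<^esub> v)"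

definition independence_number :: "('a, 'b) pre_digraph \<Rightarrow> nat" where
  "independence_number G = Max {card S | S. independent_vertices G S}"

(* In a graph, Min and Max above range over finite nonempty sets. *)

lemma (in graph) finite_MRDF_weights: "finite {sum f (verts G) | f. MRDF G f}"
proof (rule finite_subset)
  let ?n = "int (card (verts G))"
  show "{sum f (verts G) | f. MRDF G f} \<subseteq> {- ?n..2 * ?n}"
  proof clarsimp
    fix f assume f: "MRDF G f"
    have b: "f v \<ge> -1 \<and> f v \<le> 2" if "v \<in> verts G" for v
      using f that by (fastforce simp: MRDF_def)
    show "- ?n \<le> sum f (verts G) \<and> sum f (verts G) \<le> 2 * ?n"
      using sum_bounded_below[of "verts G" "-1" f] sum_bounded_above[of "verts G" f 2] b
      by (auto simp: mult.commute)
  qed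
qed simp

lemma (in graph) MRDF_const_1: "MRDF G (\<lambda>_. 1)"
proof -
  have "finite (closed_nbhd G v)" for v
    by (rule finite_subset[of _ "insert v (verts G)"]) (auto simp: closed_nbhd_def)
  then have "1 \<le> card (closed_nbhd G v)" for v
    by (metis One_nat_def Suc_leI card_gt_0_iff closed_nbhd_def insert_not_empty)
  then have "{v \<in> verts G. (\<Sum>_\<in>closed_nbhd G v. 1::int) \<ge> 1} = verts G"
    by auto
  then show ?thesis by (simp add: MRDF_def)
qed

lemma (in graph) majority_roman_domination_number_attained:
  "\<exists>f. MRDF G f \<and> sum f (verts G) = majority_roman_domination_number G"
  using Min_in[OF finite_MRDF_weights] MRDF_const_1
  unfolding majority_roman_domination_number_def by force

lemma (in graph) independence_number_attained:
  "\<exists>S. independent_vertices G S \<and> card S = independence_number G"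
proof -
  have "{card S | S. independent_vertices G S} \<subseteq> card ` Pow (verts G)"
    by (auto simp: independent_vertices_def)
  then have "finite {card S | S. independent_vertices G S}"
    by (rule finite_subset) simp
  moreover have "independent_vertices G {}"
    by (simp add: independent_vertices_def)
  ultimately show ?thesis
    using Min_in Max_in[of "{card S | S. independent_vertices G S}"]
    unfolding independence_number_def by force
qed

end

(* Give the vertices of a maximum independent set S the value -1 and all other vertices the
   value 2; the weight is 2 n - 3 |S|. A vertex v of S has only neighbours of value 2, and at
   least one of them, so f(N[v]) >= 1. It remains to see that S contains at least half of the
   vertices, which holds in every graph without cycles: every set of vertices W has a member v
   with at most one neighbour in W, namely an end of a longest path inside W; put v into the
   independent set, remove v and this neighbour from W, and repeat. *)
theory Submission
  imports Defs
begin

text \<open>A neighbour in \<open>W\<close> of the first vertex of a longest path inside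
  \<open>W\<close>, other than the second vertex of that path, would either prolong the path or
  close a cycle. As \<open>w\<close> is arbitrary, the case of no neighbour in \<open>W\<close> is
  included.\<close>

lemma (in graph) acyclic_imp_ex_leaf:
  assumes acyclic: "\<not> (\<exists>p. cycle p \<and> 3 \<le> length p)"
    and W: "W \<subseteq> verts G" "W \<noteq> {}"
  shows "\<exists>v\<in>W. \<exists>w. \<forall>y\<in>W. v \<rightarrow> y \<longrightarrow> y = w"
proof -
  define P where "P p \<longleftrightarrow> (\<exists>u v. apath u p v \<and> set (awalk_verts u p) \<subseteq> W)" for p
  from W obtain x where "x \<in> W" "x \<in> verts G" by blast
  then have "P []"
    by (auto simp: P_def apath_Nil_iff intro!: exI[of _ x])
  moreover have "\<forall>p. P p \<longrightarrow> length p < Suc (card (verts G))"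
    using length_apath_less by (fastforce simp: P_def)
  ultimately obtain p where "P p" and max: "\<And>q. P q \<Longrightarrow> length q \<le> length p"
    using ex_has_greatest_nat[of P "[]" length "Suc (card (verts G))"] by blast
  then obtain u v where p: "apath u p v" "set (awalk_verts u p) \<subseteq> W"
    by (auto simp: P_def)
  \<comment> \<open>The candidate for \<open>w\<close> is the second vertex of the path. For
    \<open>p = []\<close> it is an unspecified vertex, which does no harm.\<close>
  have "y = head G (hd p)" if "y \<in> W" "u \<rightarrow> y" for y
  proof (rule ccontr)
    assume neq: "y \<noteq> head G (hd p)"
    from \<open>u \<rightarrow> y\<close> have "y \<rightarrow> u"
      using sym_arcs by (rule arcs_ends_symmetric[rotated])
    then obtain e where e: "e \<in> arcs G" "tail G e = y" "head G e = u" ..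
    have "y \<in> set (awalk_verts u p)"
    proof (rule ccontr)
      assume "y \<notin> set (awalk_verts u p)"
      with e p \<open>y \<in> W\<close> have "P (e # p)"
        by (auto simp: P_def apath_Cons_iff intro!: exI[of _ y] exI[of _ v])
      then show False using max by fastforce
    qed
    \<comment> \<open>\<open>q\<close> is the part of the path from \<open>u\<close> to
      \<open>y\<close>; the arc \<open>e\<close> from \<open>y\<close> back to \<open>u\<close>
      closes it to a cycle.\<close>
    with p(1) obtain q r where q: "p = q @ r" "awalk u q y"
      using awalk_decomp unfolding apath_def by blast
    with p(1) have "apath u q y"
      by (auto simp: apath_append_iff)
    with e have "cycle (e # q)"
      by (auto simp: cycle_def apath_def awalk_Cons_iff intro!: exI[of _ y])
    \<comment> \<open>This rules out the trivial 2-cycle along one edge: \<open>q = []\<close> would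
      give \<open>y = u\<close>, and a single arc would make \<open>y\<close> the second vertex of
      the path.\<close>
    moreover have "2 \<le> length q"
    proof -
      have "q \<noteq> []"
        using q(2) \<open>u \<rightarrow> y\<close> adj_not_same by (auto simp: awalk_Nil_iff)
      moreover have "q \<noteq> [a]" for a
        using q neq by (auto simp: awalk_simps)
      ultimately show ?thesis
        by (cases q; cases "tl q") auto
    qed
    ultimately show False using acyclic by fastforce
  qed
  moreover have "u \<in> W"
    using p hd_in_awalk_verts(2)[OF p(1)] by blast
  ultimately show ?thesis by blast
qed

text \<open>Each round takes at most two vertices from \<open>W\<close> and adds one to
  \<open>S\<close>. Shrinking a vertex set instead of the graph keeps the acyclicity assumption the
  same throughout the induction.\<close>

lemma (in graph) acyclic_imp_ex_large_independent:
  assumes acyclic: "\<not> (\<exists>p. cycle p \<and> 3 \<le> length p)"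
    and "W \<subseteq> verts G"
  shows "\<exists>S\<subseteq>W. independent_vertices G S \<and> card W \<le> 2 * card S"
  using finite_subset[OF \<open>W \<subseteq> verts G\<close> finite_verts] \<open>W \<subseteq> verts G\<close>
proof (induction W rule: finite_psubset_induct)
  case (psubset W)
  show ?case
  proof (cases "W = {}")
    case True
    then show ?thesis by (auto simp: independent_vertices_def)
  next
    case False
    then obtain v w where v: "v \<in> W" and w: "\<And>y. y \<in> W \<Longrightarrow> v \<rightarrow> y \<Longrightarrow> y = w"
      using acyclic_imp_ex_leaf[OF acyclic psubset.prems] by blast
    have "W - {v, w} \<subset> W" using v by blast
    then obtain S where S: "S \<subseteq> W - {v, w}" "independent_vertices G S"
        "card (W - {v, w}) \<le> 2 * card S"
      using psubset by (meson order_trans psubset_imp_subset)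
    \<comment> \<open>Inside \<open>W\<close> only \<open>w\<close> can be adjacent to
      \<open>v\<close>, and \<open>S\<close> avoids \<open>w\<close>.\<close>
    have "\<not> v \<rightarrow> y" "\<not> y \<rightarrow> v" if "y \<in> S" for y
      using that S(1) w arcs_ends_symmetric[OF sym_arcs, of y v] by blast+
    then have "independent_vertices G (insert v S)"
      using S(2) v psubset.prems adj_not_same by (auto simp: independent_vertices_def)
    moreover have "card W \<le> 2 * card (insert v S)"
    proof -
      have "finite S" "v \<notin> S" using S(1) psubset.hyps finite_subset by blast+
      moreover have "card W - card {v, w} \<le> card (W - {v, w})"
        by (rule diff_card_le_card_Diff) simp
      moreover have "card {v, w} \<le> 2" by (simp add: card_insert_if)
      ultimately show ?thesis using S(3) by simp
    qed
    ultimately show ?thesis using S(1) v by blast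
  qed
qed

lemma (in graph) card_le_independence_number:
  assumes "independent_vertices G S"
  shows "card S \<le> independence_number G"
proof -
  have "{card S | S. independent_vertices G S} \<subseteq> card ` Pow (verts G)"
    by (auto simp: independent_vertices_def)
  then have "finite {card S | S. independent_vertices G S}"
    by (rule finite_subset) simp
  then show ?thesis
    using assms unfolding independence_number_def by (intro Max_ge) auto
qed

text \<open>A walk from \<open>v\<close> to some other vertex starts with an arc leaving
  \<open>v\<close>.\<close>

lemma (in graph) connected_imp_ex_neighbour:
  assumes "connected G" "2 \<le> card (verts G)" "v \<in> verts G"
  shows "\<exists>w. v \<rightarrow> w"
proof -
  obtain u where "u \<in> verts G" "u \<noteq> v"
    using assms(2,3) by (metis card_2_iff' card_le_Suc0_iff_eq finite_verts not_less_eq_eq numeral_2_eq_2)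
  moreover have "strongly_connected G"
    using sym_arcs assms(1) by (rule symmetric_connected_imp_strongly_connected)
  ultimately have "v \<rightarrow>\<^sup>* u"
    using assms(3) by blast
  then show ?thesis
    using \<open>u \<noteq> v\<close> by (cases rule: converse_reachable_cases) auto
qed

lemma (in graph) majority_roman_domination_number_le:
  assumes "MRDF G f"
  shows "majority_roman_domination_number G \<le> sum f (verts G)"
  using assms finite_MRDF_weights unfolding majority_roman_domination_number_def
  by (intro Min_le) auto

theorem proposition16:
  fixes T :: "('a, 'b) pre_digraph" and n :: nat
  assumes "undirected_tree T"
    and "card (verts T) = n"
    and "n \<ge> 2"
  shows "majority_roman_domination_number T \<le> 2 * int n - 3 * int (independence_number T)"
proof -
  interpret graph T using assms(1) by (simp add: undirected_tree_def)
  obtain S where S: "independent_vertices T S" "card S = independence_number T"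
    using independence_number_attained by blast
  then have "S \<subseteq> verts T" by (simp add: independent_vertices_def)
  then have "finite S" by (rule finite_subset) simp
  have half: "n \<le> 2 * card S"
  proof -
    obtain S' where "independent_vertices T S'" "card (verts T) \<le> 2 * card S'"
      using acyclic_imp_ex_large_independent[of "verts T"] assms(1)
      by (auto simp: undirected_tree_def)
    with card_le_independence_number show ?thesis
      using S(2) assms(2) by fastforce
  qed
  define f :: "'a \<Rightarrow> int" where "f v = (if v \<in> S then -1 else 2)" for v
  \<comment> \<open>Connectedness and \<open>n \<ge> 2\<close> give a neighbour; independence keeps
    it outside \<open>S\<close>.\<close>
  have nbr: "\<exists>w. v \<rightarrow>\<^bsub>T\<^esub> w \<and> w \<notin> S" if "v \<in> S" for v
    using connected_imp_ex_neighbour[of v] that S(1) \<open>S \<subseteq> verts T\<close> assms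
    by (auto simp: undirected_tree_def independent_vertices_def)
  \<comment> \<open>\<open>v\<close> contributes -1, and its neighbours, all of value 2, contribute
    at least 2 together.\<close>
  have good: "1 \<le> sum f (closed_nbhd T v)" if v: "v \<in> S" for v
  proof -
    let ?N = "{u. u \<rightarrow>\<^bsub>T\<^esub> v}"
    have "finite ?N"
      by (rule finite_subset[OF _ finite_verts]) (auto simp: adj_in_verts)
    have N: "u \<notin> S" if "u \<in> ?N" for u
      using that v S(1) by (auto simp: independent_vertices_def)
    obtain w where "w \<in> ?N"
      using nbr[OF v] arcs_ends_symmetric[OF sym_arcs] by blast
    then have "f w \<le> sum f ?N"
      using \<open>finite ?N\<close> N by (intro member_le_sum) (auto simp: f_def)
    then have "2 \<le> sum f ?N"
      using N \<open>w \<in> ?N\<close> by (simp add: f_def)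
    moreover have "v \<notin> ?N" using N v by blast
    ultimately show ?thesis
      using v \<open>finite ?N\<close> by (simp add: closed_nbhd_def f_def)
  qed
  \<comment> \<open>With \<open>half\<close>, this yields the majority condition.\<close>
  have "card S \<le> card {v \<in> verts T. 1 \<le> sum f (closed_nbhd T v)}"
    using good \<open>S \<subseteq> verts T\<close> by (intro card_mono) auto
  moreover have "\<exists>w\<in>verts T. u \<rightarrow>\<^bsub>T\<^esub> w \<and> f w = 2" if "f u = -1" for u
    using that nbr[of u] adj_in_verts(2) by (fastforce simp: f_def split: if_splits)
  ultimately have "MRDF T f"
    using half assms(2) unfolding MRDF_def by (auto simp: f_def)
  then have "majority_roman_domination_number T \<le> sum f (verts T)"
    by (rule majority_roman_domination_number_le)
  also have "sum f (verts T) = sum f (verts T - S) + sum f S"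
    using \<open>S \<subseteq> verts T\<close> by (intro sum.subset_diff) auto
  also have "sum f S = - int (card S)"
    by (simp add: f_def)
  also have "sum f (verts T - S) = 2 * int (card (verts T - S))"
    by (simp add: f_def)
  also have "int (card (verts T - S)) = int n - int (card S)"
    using \<open>S \<subseteq> verts T\<close> \<open>finite S\<close> assms(2) card_mono[OF finite_verts]
    by (auto simp: card_Diff_subset of_nat_diff)
  finally show ?thesis using S(2) by simp
qed

end
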